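(* Let $(p_i^{(n)},q_i^{(n)})_{i,n\in\mathcal{N}}$ be the steady-state probabilities of the decomposed Markovian model of the social platform with Newsfeed size $M\ge1$ and Wall size $K\ge1$. For each label $i\in\mathcal{N}$, the column vectors $\mathbf{p}_i:=(p_i^{(1)},\ldots,p_i^{(N)})^T$ and $\mathbf{q}_i:=(q_i^{(1)},\ldots,q_i^{(N)})^T$ are solution of the linear system $$\mathbf{p}_i=\mathbf{A}\,\mathbf{p}_i+\mathbf{b}_i,\qquad \mathbf{q}_i=\mathbf{C}\,\mathbf{p}_i+\mathbf{d}_i,$$ where $\mathbf{A}=(a_{j,k})$ and $\mathbf{C}=(c_{j,k})$ are the $N\times N$ matrices and $\mathbf{b}_i=(b_{j,i})_{j=1}^N$, $\mathbf{d}_i=(d_{j,i})_{j=1}^N$ the column vectors with entries $$a_{j,k}=\frac{\mu^{(k)}\,\mathbf{1}_{\{k\in\mathcal{L}^{(j)}\}}}{\sum_{\ell\in\mathcal{L}^{(j)}}(\lambda^{(\ell)}+\mu^{(\ell)})},\quad b_{j,i}=\frac{\lambda^{(i)}\,\mathbf{1}_{\{i\in\mathcal{L}^{(j)}\}}}{\sum_{\ell\in\mathcal{L}^{(j)}}(\lambda^{(\ell)}+\mu^{(\ell)})},\quad c_{j,k}=\frac{\mu^{(j)}\,\mathbf{1}_{\{j=k\}}}{\lambda^{(j)}+\mu^{(j)}},\quad d_{j,i}=\frac{\lambda^{(i)}\,\mathbf{1}_{\{j=i\}}}{\lambda^{(i)}+\mu^{(i)}}.$$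
   Context: Platform. There are $N$ users, $\mathcal{N}=\{1,\dots,N\}$. Each user $n$ has a nonempty set of leaders $\mathcal{L}^{(n)}\subseteq\mathcal{N}\setminus\{n\}$, and rates $\lambda^{(n)}\ge 0$ (self-posting) and $\mu^{(n)}\ge 0$ (re-posting) with $\lambda^{(n)}+\mu^{(n)}>0$. Each user has a Newsfeed, a list of exactly $M$ posts, and a Wall, a list of exactly $K$ posts. Each post carries as label the index of the user who originally created it. User $n$ generates new posts (of label $n$) on his Wall according to a Poisson process of rate $\lambda^{(n)}$, and, according to a Poisson process of rate $\mu^{(n)}$, selects uniformly at random one of the $M$ entries of his Newsfeed and re-posts it (keeping its label) on his Wall. All processes are independent. Every post put on a user's Wall instantaneously appears on the Newsfeeds of all users who have him as leader. Each new entry of a list replaces an older entry of that list chosen uniformly at random. Decomposed model. The states of different lists are decoupled by replacing, in the transition rates, the current composition of any Newsfeed from which posts are selected by its steady-state average probabilities. Precisely, let $(p_i^{(n)})_{i,n\in\mathcal{N}}$ be nonnegative numbers with $\sum_{i}p_i^{(n)}=1$ for all $n$. (Newsfeed chain of user $n$.) The state is $\mathbf{x}^{(n)}=(x_1^{(n)},\dots,x_N^{(n)})$, nonnegative integers with sum $M$, where $x_i^{(n)}$ is the number of posts of label $i$. Posts of label $i$ arrive at rate $\lambda^{(i)}\mathbf{1}_{\{i\in\mathcal{L}^{(n)}\}}+\sum_{k\in\mathcal{L}^{(n)}}\mu^{(k)}p_i^{(k)}$; each arriving post replaces one of the $M$ present posts chosen uniformly at random. This is a continuous-time Markov chain. (Wall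 chain of user $n$.) The state is $\mathbf{y}^{(n)}=(y_1^{(n)},\dots,y_N^{(n)})$, nonnegative integers with sum $K$, where $y_i^{(n)}$ is the number of posts of label $i$. Posts of label $i$ arrive at rate $\lambda^{(n)}\mathbf{1}_{\{i=n\}}+\mu^{(n)}p_i^{(n)}$; each arriving post replaces one of the $K$ present posts chosen uniformly at random. The family $(p_i^{(n)},q_i^{(n)})_{i,n}$ is a family of steady-state probabilities of the model with sizes $(M,K)$ if, for all $i,n$, $p_i^{(n)}=\mathbb{E}[x_i^{(n)}]/M$ under the stationary distribution of the Newsfeed chain of user $n$ (with arrival rates built from the same numbers $p_i^{(n)}$), and $q_i^{(n)}=\mathbb{E}[y_i^{(n)}]/K$ under the stationary distribution of the Wall chain of user $n$. Thus $p_i^{(n)}$ (resp. $q_i^{(n)}$) is the steady-state probability that a post found on the Newsfeed (resp. Wall) of user $n$ has label $i$. *)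

theory Defs
  imports "HOL-Probability.Probability"
begin

text \<open>
  A continuous-time Markov chain on a finite set \<open>S\<close> is given by its jump rates \<open>q x y\<close> between
  distinct states; the values \<open>q x x\<close> are never used, since a jump from \<open>x\<close> to itself
  (a post replaced by one with the same label) does not change the state.
\<close>

definition generator :: "'s set \<Rightarrow> ('s \<Rightarrow> 's \<Rightarrow> real) \<Rightarrow> 's \<Rightarrow> 's \<Rightarrow> real" where
  "generator S q x y = (if x = y then - (\<Sum>z\<in>S - {x}. q x z) else q x y)"

definition stationary_distribution :: "'s set \<Rightarrow> ('s \<Rightarrow> 's \<Rightarrow> real) \<Rightarrow> 's pmf \<Rightarrow> bool" where
  "stationary_distribution S q \<pi> \<longleftrightarrow>
     set_pmf \<pi> \<subseteq> S \<and> (\<forall>y\<in>S. (\<Sum>x\<in>S. pmf \<pi> x * generator S q x y) = 0)"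

text \<open>
  The state of a list of \<open>m\<close> posts is the function mapping each label to its number of occurrences.
\<close>

definition list_states :: "nat \<Rightarrow> ('n::finite \<Rightarrow> nat) set" where
  "list_states m = {x. (\<Sum>i\<in>UNIV. x i) = m}"

text \<open>
  \<open>replace_post j i x\<close> exchanges one post of label \<open>j\<close> for one of label \<open>i\<close> (for \<open>i = j\<close> this is \<open>x\<close>).
  It is meaningful only for \<open>x j > 0\<close>; the truncated case \<open>x j = 0\<close> has weight \<open>0\<close> in \<open>list_rate\<close>.
\<close>

definition replace_post :: "'n \<Rightarrow> 'n \<Rightarrow> ('n \<Rightarrow> nat) \<Rightarrow> 'n \<Rightarrow> nat" where
  "replace_post j i x = (let z = x(j := x j - 1) in z(i := z i + 1))"

text \<open>
  Posts of label \<open>i\<close> arrive at rate \<open>r i\<close>, and the evicted post, uniform among the \<open>m\<close> present ones,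
  has label \<open>j\<close> with probability \<open>x j / m\<close>.
\<close>

definition list_rate ::
  "nat \<Rightarrow> ('n::finite \<Rightarrow> real) \<Rightarrow> ('n \<Rightarrow> nat) \<Rightarrow> ('n \<Rightarrow> nat) \<Rightarrow> real" where
  "list_rate m r x y =
     (\<Sum>i\<in>UNIV. \<Sum>j\<in>UNIV. if replace_post j i x = y then r i * (real (x j) / real m) else 0)"

text \<open>Below, \<open>p i $ n\<close> and \<open>q i $ n\<close> are the probabilities of label \<open>i\<close> at user \<open>n\<close>.\<close>

definition newsfeed_arrival ::
  "('n::finite \<Rightarrow> 'n set) \<Rightarrow> ('n \<Rightarrow> real) \<Rightarrow> ('n \<Rightarrow> real) \<Rightarrow> ('n \<Rightarrow> real ^ 'n) \<Rightarrow> 'n \<Rightarrow> 'n \<Rightarrow> real" where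
  "newsfeed_arrival L lam mu p n i = lam i * of_bool (i \<in> L n) + (\<Sum>k\<in>L n. mu k * p i $ k)"

definition wall_arrival ::
  "('n::finite \<Rightarrow> real) \<Rightarrow> ('n \<Rightarrow> real) \<Rightarrow> ('n \<Rightarrow> real ^ 'n) \<Rightarrow> 'n \<Rightarrow> 'n \<Rightarrow> real" where
  "wall_arrival lam mu p n i = lam n * of_bool (i = n) + mu n * p i $ n"

text \<open>
  When the total arrival rate is positive, each of these chains has exactly one stationary
  distribution (the labels with positive arrival rate span the only closed class), so the
  existential quantifiers below range over a single \<open>\<pi>\<close>.
\<close>

definition steady_state_probabilities ::
  "nat \<Rightarrow> nat \<Rightarrow> ('n::finite \<Rightarrow> 'n set) \<Rightarrow> ('n \<Rightarrow> real) \<Rightarrow> ('n \<Rightarrow> real) \<Rightarrow>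
   ('n \<Rightarrow> real ^ 'n) \<Rightarrow> ('n \<Rightarrow> real ^ 'n) \<Rightarrow> bool" where
  "steady_state_probabilities M K L lam mu p q \<longleftrightarrow>
     (\<forall>i n. 0 \<le> p i $ n) \<and> (\<forall>n. (\<Sum>i\<in>UNIV. p i $ n) = 1) \<and>
     (\<forall>n. \<exists>\<pi>. stationary_distribution (list_states M) (list_rate M (newsfeed_arrival L lam mu p n)) \<pi> \<and>
        (\<forall>i. p i $ n = measure_pmf.expectation \<pi> (\<lambda>x. real (x i)) / real M)) \<and>
     (\<forall>n. \<exists>\<pi>. stationary_distribution (list_states K) (list_rate K (wall_arrival lam mu p n)) \<pi> \<and>
        (\<forall>i. q i $ n = measure_pmf.expectation \<pi> (\<lambda>y. real (y i)) / real K))"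

definition A_mat ::
  "('n::finite \<Rightarrow> 'n set) \<Rightarrow> ('n \<Rightarrow> real) \<Rightarrow> ('n \<Rightarrow> real) \<Rightarrow> real ^ 'n ^ 'n" where
  "A_mat L lam mu = (\<chi> j k. mu k * of_bool (k \<in> L j) / (\<Sum>l\<in>L j. lam l + mu l))"

definition b_vec ::
  "('n::finite \<Rightarrow> 'n set) \<Rightarrow> ('n \<Rightarrow> real) \<Rightarrow> ('n \<Rightarrow> real) \<Rightarrow> 'n \<Rightarrow> real ^ 'n" where
  "b_vec L lam mu i = (\<chi> j. lam i * of_bool (i \<in> L j) / (\<Sum>l\<in>L j. lam l + mu l))"

definition C_mat :: "('n::finite \<Rightarrow> real) \<Rightarrow> ('n \<Rightarrow> real) \<Rightarrow> real ^ 'n ^ 'n" where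
  "C_mat lam mu = (\<chi> j k. mu j * of_bool (j = k) / (lam j + mu j))"

definition d_vec :: "('n::finite \<Rightarrow> real) \<Rightarrow> ('n \<Rightarrow> real) \<Rightarrow> 'n \<Rightarrow> real ^ 'n" where
  "d_vec lam mu i = (\<chi> j. lam i * of_bool (j = i) / (lam i + mu i))"

end

theory Submission
  imports Defs
begin

text \<open>
  Under a stationary distribution the generator applied to any function has mean zero. For the function
  \<open>x \<mapsto> x k\<close> the generator gives \<open>r k - R * x k / m\<close>, where \<open>R\<close> is the total arrival rate, so the mean
  fraction of label \<open>k\<close> in a list is the share of label \<open>k\<close> among the arrivals.
\<close>

lemma finite_list_states: "finite (list_states m :: ('n::finite \<Rightarrow> nat) set)"
proof (rule finite_subset)
  show "list_states m \<subseteq> Pi\<^sub>E (UNIV :: 'n set) (\<lambda>_. {..m})"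
    by (auto simp: list_states_def intro: member_le_sum)
qed (auto intro: finite_PiE)

text \<open>The diagonal entry of the generator is minus the total exit rate, and this supplies
  every \<open>- f x\<close> on the right. The term \<open>y = x\<close> vanishes there, so the
  right-hand sum can run over all of \<open>S\<close> whatever the value \<open>q x x\<close>, which
  \<open>list_rate\<close> leaves nonzero in general.\<close>

lemma sum_generator:
  assumes "finite S" "x \<in> S"
  shows "(\<Sum>y\<in>S. generator S q x y * f y) = (\<Sum>y\<in>S. q x y * (f y - f x))"
proof -
  have "(\<Sum>y\<in>S. generator S q x y * f y) =
      generator S q x x * f x + (\<Sum>y\<in>S - {x}. generator S q x y * f y)"
    using assms by (rule sum.remove)
  also have "(\<Sum>y\<in>S - {x}. generator S q x y * f y) = (\<Sum>y\<in>S - {x}. q x y * f y)"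
    by (intro sum.cong) (auto simp: generator_def)
  also have "generator S q x x * f x + \<dots> = (\<Sum>y\<in>S - {x}. q x y * (f y - f x))"
    by (simp add: generator_def sum_subtractf sum_distrib_right right_diff_distrib)
  also have "\<dots> = (\<Sum>y\<in>S. q x y * (f y - f x))"
    using assms by (simp add: sum.remove)
  finally show ?thesis .
qed

text \<open>Exchanging the two sums moves the generator from the test function \<open>f\<close> onto
  \<open>\<pi>\<close>, where stationarity makes each coefficient of \<open>f y\<close>
  zero.\<close>

lemma stationary_distribution_balance:
  assumes "finite S" "stationary_distribution S q \<pi>"
  shows "(\<Sum>x\<in>S. pmf \<pi> x * (\<Sum>y\<in>S. q x y * (f y - f x))) = 0"
proof -
  have "(\<Sum>x\<in>S. pmf \<pi> x * (\<Sum>y\<in>S. q x y * (f y - f x))) =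
      (\<Sum>x\<in>S. \<Sum>y\<in>S. pmf \<pi> x * generator S q x y * f y)"
    using assms(1) by (simp flip: sum_generator add: sum_distrib_left mult.assoc)
  also have "\<dots> = (\<Sum>y\<in>S. (\<Sum>x\<in>S. pmf \<pi> x * generator S q x y) * f y)"
    by (subst sum.swap) (simp add: sum_distrib_right)
  also have "\<dots> = 0"
    using assms(2) by (simp add: stationary_distribution_def)
  finally show ?thesis .
qed

text \<open>Positivity of \<open>x j\<close> makes the truncated subtraction exact. In the reals the
  gain and the loss are two independent indicators, which cancel by themselves when
  \<open>i = j\<close>.\<close>

lemma replace_post_apply:
  assumes "x j > 0"
  shows "real (replace_post j i x k) = real (x k) + of_bool (i = k) - of_bool (j = k)"
  using assms by (auto simp: replace_post_def Let_def)

lemma replace_post_in_list_states: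
  fixes x :: "'n::finite \<Rightarrow> nat"
  assumes "x \<in> list_states m" "x j > 0"
  shows "replace_post j i x \<in> list_states m"
proof -
  have "real (\<Sum>k\<in>UNIV. replace_post j i x k) = real (\<Sum>k\<in>UNIV. x k)"
    by (simp add: replace_post_apply[of x j, OF assms(2)] sum.distrib sum_subtractf of_bool_def)
  then show ?thesis
    using assms(1) by (simp only: list_states_def mem_Collect_eq of_nat_eq_iff)
qed

text \<open>An arrival of label \<open>i\<close> that evicts label \<open>j\<close> changes the
  count of \<open>k\<close> by \<open>of_bool (i = k) - of_bool (j = k)\<close>. Averaging over the
  evicted label, with weights \<open>x j / m\<close> of sum 1, leaves a gain at rate
  \<open>r k\<close> and a loss at rate \<open>x k / m\<close> times the total arrival rate.\<close>

lemma list_rate_drift: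
  fixes x :: "'n::finite \<Rightarrow> nat"
  assumes "m \<ge> 1" "x \<in> list_states m"
  shows "(\<Sum>y\<in>list_states m. list_rate m r x y * (real (y k) - real (x k))) =
      r k - (\<Sum>i\<in>UNIV. r i) * (real (x k) / real m)"
proof -
  have total: "(\<Sum>j\<in>UNIV. real (x j) / real m) = 1"
    using assms by (simp add: list_states_def flip: sum_divide_distrib of_nat_sum)
  \<comment> \<open>For fixed \<open>i\<close> and \<open>j\<close> only the target
    \<open>replace_post j i x\<close> contributes. If \<open>x j = 0\<close>, truncation would give
    a list of \<open>m + 1\<close> posts, outside \<open>list_states m\<close>, but both sides then
    carry the factor 0.\<close>
  have inner: "(\<Sum>y\<in>list_states m.
        (if replace_post j i x = y then r i * (real (x j) / real m) else 0) * (real (y k) - real (x k)))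
      = r i * (real (x j) / real m) * (of_bool (i = k) - of_bool (j = k))" for i j
  proof (cases "x j = 0")
    case False
    then have "replace_post j i x \<in> list_states m"
      using assms(2) by (intro replace_post_in_list_states) auto
    moreover have "(if replace_post j i x = y then r i * (real (x j) / real m) else 0) * (real (y k) - real (x k))
        = (if replace_post j i x = y then r i * (real (x j) / real m) * (real (y k) - real (x k)) else 0)" for y
      by simp
    moreover have "real (replace_post j i x k) - real (x k) = of_bool (i = k) - of_bool (j = k)"
      using False replace_post_apply[of x j i k] by simp
    ultimately show ?thesis
      by (simp only: sum.delta' finite_list_states if_True)
  next
    case True
    then show ?thesis
      by (simp cong: if_cong)
  qed
  have "(\<Sum>y\<in>list_states m. list_rate m r x y * (real (y k) - real (x k))) =
      (\<Sum>y\<in>list_states m. \<Sum>i\<in>UNIV. \<Sum>j\<in>UNIV.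
        (if replace_post j i x = y then r i * (real (x j) / real m) else 0) * (real (y k) - real (x k)))"
    by (simp only: list_rate_def sum_distrib_right)
  also have "\<dots> = (\<Sum>i\<in>UNIV. \<Sum>j\<in>UNIV. \<Sum>y\<in>list_states m.
        (if replace_post j i x = y then r i * (real (x j) / real m) else 0) * (real (y k) - real (x k)))"
    by (subst sum.swap) (intro sum.cong refl sum.swap)
  also have "\<dots> = (\<Sum>i\<in>UNIV. \<Sum>j\<in>UNIV.
      r i * (real (x j) / real m) * (of_bool (i = k) - of_bool (j = k)))"
    by (simp only: inner)
  also have "\<dots> = (\<Sum>i\<in>UNIV. r i * of_bool (i = k) * (\<Sum>j\<in>UNIV. real (x j) / real m)
      - r i * (\<Sum>j\<in>UNIV. real (x j) / real m * of_bool (j = k)))"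
    by (simp only: sum_distrib_left sum_subtractf[symmetric]) (simp add: algebra_simps diff_divide_distrib)
  also have "\<dots> = (\<Sum>i\<in>UNIV. r i * of_bool (i = k) - r i * (real (x k) / real m))"
    by (simp only: total sum_mult_of_bool_eq finite) simp
  also have "\<dots> = r k - (\<Sum>i\<in>UNIV. r i) * (real (x k) / real m)"
    by (simp add: sum_subtractf sum_distrib_right sum_divide_distrib sum_mult_of_bool_eq)
  finally show ?thesis .
qed

text \<open>The drift is affine in \<open>x k\<close>, so its mean involves \<open>\<pi>\<close>
  only through the mean of \<open>x k\<close>, and the balance equation determines that mean without
  a formula for \<open>\<pi>\<close>. The product form avoids dividing by a total rate not yet known
  to be nonzero.\<close>

lemma stationary_list_mean:
  fixes r :: "'n::finite \<Rightarrow> real"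
  assumes "m \<ge> 1" "stationary_distribution (list_states m) (list_rate m r) \<pi>"
  shows "(\<Sum>i\<in>UNIV. r i) * (measure_pmf.expectation \<pi> (\<lambda>x. real (x k)) / real m) = r k"
proof -
  let ?S = "list_states m :: ('n \<Rightarrow> nat) set" and ?R = "\<Sum>i\<in>UNIV. r i"
  have supp: "set_pmf \<pi> \<subseteq> ?S"
    using assms(2) by (simp add: stationary_distribution_def)
  have mean: "measure_pmf.expectation \<pi> (\<lambda>x. real (x k)) = (\<Sum>x\<in>?S. real (x k) * pmf \<pi> x)"
    using supp by (intro integral_measure_pmf_real finite_list_states) auto
  have "0 = (\<Sum>x\<in>?S. pmf \<pi> x * (\<Sum>y\<in>?S. list_rate m r x y * (real (y k) - real (x k))))"
    by (rule stationary_distribution_balance[OF finite_list_states assms(2), symmetric])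
  also have "\<dots> = (\<Sum>x\<in>?S. pmf \<pi> x * (r k - ?R * (real (x k) / real m)))"
    by (intro sum.cong refl) (simp add: list_rate_drift[OF assms(1)])
  also have "\<dots> = r k * (\<Sum>x\<in>?S. pmf \<pi> x) - ?R * ((\<Sum>x\<in>?S. real (x k) * pmf \<pi> x) / real m)"
    by (simp add: right_diff_distrib sum_subtractf sum_distrib_left sum_divide_distrib mult_ac)
  also have "(\<Sum>x\<in>?S. pmf \<pi> x) = 1"
    by (rule sum_pmf_eq_1[OF finite_list_states supp])
  finally show ?thesis
    by (simp add: mean)
qed

text \<open>The re-posts of a leader \<open>k\<close> are split among the labels with proportions
  \<open>p i $ k\<close> of sum 1, so they contribute \<open>mu k\<close> in total. This produces
  the common denominator of \<open>A_mat\<close> and \<open>b_vec\<close>.\<close>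

lemma sum_newsfeed_arrival:
  assumes "\<And>k. (\<Sum>i\<in>UNIV. p i $ k) = 1"
  shows "(\<Sum>i\<in>UNIV. newsfeed_arrival L lam mu p n i) = (\<Sum>l\<in>L n. lam l + mu l)"
proof -
  have "(\<Sum>i\<in>UNIV. \<Sum>k\<in>L n. mu k * p i $ k) = (\<Sum>k\<in>L n. mu k)"
    by (subst sum.swap) (simp add: assms flip: sum_distrib_left)
  moreover have "(\<Sum>i\<in>UNIV. lam i * of_bool (i \<in> L n)) = (\<Sum>i\<in>L n. lam i)"
    by (rule sum.mono_neutral_cong_right) auto
  ultimately show ?thesis
    by (simp add: newsfeed_arrival_def sum.distrib)
qed

lemma sum_wall_arrival:
  assumes "(\<Sum>i\<in>UNIV. p i $ n) = 1"
  shows "(\<Sum>i\<in>UNIV. wall_arrival lam mu p n i) = lam n + mu n"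
  by (simp add: wall_arrival_def sum.distrib assms of_bool_def flip: sum_distrib_left)

theorem theorem2:
  fixes L :: "'n::finite \<Rightarrow> 'n set"
    and lam mu :: "'n \<Rightarrow> real"
    and M K :: nat
    and p q :: "'n \<Rightarrow> real ^ 'n"
  assumes "\<And>n. L n \<noteq> {}"
    and "\<And>n. L n \<subseteq> UNIV - {n}"
    and "\<And>n. lam n \<ge> 0"
    and "\<And>n. mu n \<ge> 0"
    and "\<And>n. lam n + mu n > 0"
    and "M \<ge> 1"
    and "K \<ge> 1"
    and "steady_state_probabilities M K L lam mu p q"
  shows "\<forall>i. p i = A_mat L lam mu *v p i + b_vec L lam mu i \<and>
             q i = C_mat lam mu *v p i + d_vec lam mu i"
proof (intro allI conjI)
  fix i
  have p_sum: "(\<Sum>i\<in>UNIV. p i $ k) = 1" for k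
    using assms(8) by (simp add: steady_state_probabilities_def)
  show "p i = A_mat L lam mu *v p i + b_vec L lam mu i"
  proof (rule vec_eq_iff[THEN iffD2, rule_format])
    fix n
    let ?D = "\<Sum>l\<in>L n. lam l + mu l"
    obtain \<pi> where "stationary_distribution (list_states M) (list_rate M (newsfeed_arrival L lam mu p n)) \<pi>"
      and "p i $ n = measure_pmf.expectation \<pi> (\<lambda>x. real (x i)) / real M"
      using assms(8) unfolding steady_state_probabilities_def by metis
    then have balance: "?D * p i $ n = newsfeed_arrival L lam mu p n i"
      using stationary_list_mean[OF assms(6)] sum_newsfeed_arrival[of p L lam mu n, OF p_sum] by metis
    have "?D > 0"
      using assms(1,5) by (intro sum_pos) auto
    then have "p i $ n = newsfeed_arrival L lam mu p n i / ?D"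
      using balance by (simp add: field_simps)
    \<comment> \<open>The indicator in row \<open>n\<close> of \<open>A_mat\<close> restricts the
      sum over all users to the leaders of \<open>n\<close>.\<close>
    moreover have "(A_mat L lam mu *v p i) $ n = (\<Sum>k\<in>L n. mu k * p i $ k) / ?D"
      unfolding A_mat_def matrix_vector_mult_def sum_divide_distrib
      by (simp, rule sum.mono_neutral_cong_right) auto
    ultimately show "p i $ n = (A_mat L lam mu *v p i + b_vec L lam mu i) $ n"
      by (simp add: b_vec_def newsfeed_arrival_def add_divide_distrib)
  qed
  show "q i = C_mat lam mu *v p i + d_vec lam mu i"
  proof (rule vec_eq_iff[THEN iffD2, rule_format])
    fix n
    obtain \<pi> where "stationary_distribution (list_states K) (list_rate K (wall_arrival lam mu p n)) \<pi>"
      and "q i $ n = measure_pmf.expectation \<pi> (\<lambda>y. real (y i)) / real K"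
      using assms(8) unfolding steady_state_probabilities_def by metis
    then have "(lam n + mu n) * q i $ n = wall_arrival lam mu p n i"
      using stationary_list_mean[OF assms(7)] sum_wall_arrival[of p n lam mu, OF p_sum] by metis
    then have "q i $ n = wall_arrival lam mu p n i / (lam n + mu n)"
      using assms(5)[of n] by (simp add: field_simps)
    moreover have "(C_mat lam mu *v p i) $ n = mu n * p i $ n / (lam n + mu n)"
      by (simp add: C_mat_def matrix_vector_mult_def of_bool_def if_distrib if_distribR cong: if_cong)
    \<comment> \<open>The denominator in \<open>d_vec\<close> belongs to user \<open>i\<close>, not
      \<open>n\<close>; the two agree when \<open>n = i\<close>, and otherwise the self-posting term
      is 0 on both sides.\<close>
    ultimately show "q i $ n = (C_mat lam mu *v p i + d_vec lam mu i) $ n"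
      by (auto simp: d_vec_def wall_arrival_def add_divide_distrib)
  qed
qed

end
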